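(* Let $V$ be an identification function with induced functional $T$ and elementary loss functions $S_\eta$, $\eta\in\mathbb{R}$. Let $(X,Y)$ be a pair of random variables with $X$ taking values in $\mathcal{X}$ and $Y$ real-valued, and let $m(\cdot\,;\beta):\mathcal{X}\to\mathbb{R}$, $\beta\in\Theta$, be a model. Suppose that there is $\epsilon>0$ such that for every $\beta\in\Theta$ and every $a\in(-\epsilon,\epsilon)$ there exists $\beta'\in\Theta$ with $m(\cdot\,;\beta)+a=m(\cdot\,;\beta')$. Suppose that there exists $\beta^*\in\Theta$ such that $$\inf_{\beta\in\Theta}\mathsf{E}\,S_\eta(m(X;\beta),Y)=\mathsf{E}\,S_\eta(m(X;\beta^* ),Y)\quad\text{for all }\eta\in\mathbb{R}.$$ Assume that the random variables $V(m(X;\beta^* )+\epsilon',Y)$ and $V(m(X;\beta^* )-\epsilon',Y)$ are integrable for some $\epsilon'>0$. Then $$m(X;\beta^* )\in T\big(Y\mid m(X;\beta^* )\big)\quad\text{almost surely.}$$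
   Context: An identification function is a function $V:\mathbb{R}\times\mathbb{R}\to\mathbb{R}$ such that $V(\cdot,y)$ is increasing (i.e. non-decreasing) and left-continuous for every $y\in\mathbb{R}$. For a probability measure $P$ on $\mathbb{R}$ write $\bar V(z,P)=\int V(z,y)\,dP(y)$, and let $\mathcal{P}$ be the class of probability measures $P$ on $\mathbb{R}$ for which $\bar V(z,P)$ exists (as a finite integral) for all $z\in\mathbb{R}$. The functional $T$ induced by $V$ is defined for $P\in\mathcal{P}$ as the interval $T(P)=[T_P^-,T_P^+]\subseteq[-\infty,\infty]$, where $T_P^-=\sup\{z\in\mathbb{R}\mid\bar V(z,P)<0\}$ and $T_P^+=\inf\{z\in\mathbb{R}\mid\bar V(z,P)>0\}$ (with $\sup\emptyset=-\infty$, $\inf\emptyset=\infty$). The elementary loss functions associated with $V$ are, for $\eta,z,y\in\mathbb{R}$, $$S_\eta(z,y)=\big(\mathbf{1}\{\eta\le z\}-\mathbf{1}\{\eta\le y\}\big)V(\eta,y).$$ Standing conventions: $\mathcal{X}$ is a measurable space; $V(z,\cdot)$ and $m(\cdot\,;\beta)$ are measurable for all $z\in\mathbb{R}$ and $\beta\in\Theta$. All conditional distributions $\mathcal{L}(Y\mid X=x)$, $x \in \mathcal{X}$, belong to $\mathcal{P}$. For a random variable $Z$, $T(Y\mid Z)$ denotes $T$ applied to the (regular) conditional distribution of $Y$ given $Z$; the conditional distribution of $Y$ given $m(X;\beta^* )$ is assumed to belong to $\mathcal{P}$ almost surely, so that $T(Y\mid m(X;\beta^* ))$ is defined. The expectations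 $\mathsf{E}\,S_\eta(m(X;\beta),Y)$ are assumed to exist as real numbers for all $\beta\in\Theta$, $\eta\in\mathbb{R}$. *)

theory Defs
  imports "HOL-Probability.Probability"
begin

definition identification_function :: "(real \<Rightarrow> real \<Rightarrow> real) \<Rightarrow> bool" where
  "identification_function V \<longleftrightarrow>
     (\<forall>y. mono (\<lambda>z. V z y) \<and> (\<forall>z. continuous (at_left z) (\<lambda>z. V z y)))"

definition Vbar :: "(real \<Rightarrow> real \<Rightarrow> real) \<Rightarrow> real \<Rightarrow> real measure \<Rightarrow> real" where
  "Vbar V z P = (\<integral>y. V z y \<partial>P)"

definition id_class :: "(real \<Rightarrow> real \<Rightarrow> real) \<Rightarrow> real measure set" where
  "id_class V = {P. prob_space P \<and> sets P = sets borel \<and> (\<forall>z. integrable P (V z))}"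

definition T_lower :: "(real \<Rightarrow> real \<Rightarrow> real) \<Rightarrow> real measure \<Rightarrow> ereal" where
  "T_lower V P = Sup (ereal ` {z. Vbar V z P < 0})"

definition T_upper :: "(real \<Rightarrow> real \<Rightarrow> real) \<Rightarrow> real measure \<Rightarrow> ereal" where
  "T_upper V P = Inf (ereal ` {z. Vbar V z P > 0})"

text \<open>Meaningful only for \<open>P \<in> id_class V\<close>: outside this class the Bochner integral in
  \<open>Vbar\<close> takes the default value 0.\<close>
definition induced_functional :: "(real \<Rightarrow> real \<Rightarrow> real) \<Rightarrow> real measure \<Rightarrow> ereal set" where
  "induced_functional V P = {T_lower V P .. T_upper V P}"

definition elementary_loss :: "(real \<Rightarrow> real \<Rightarrow> real) \<Rightarrow> real \<Rightarrow> real \<Rightarrow> real \<Rightarrow> real" where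
  "elementary_loss V \<eta> z y = (of_bool (\<eta> \<le> z) - of_bool (\<eta> \<le> y)) * V \<eta> y"

text \<open>\<open>K\<close> is (a version of) the regular conditional distribution of the real random variable
  \<open>Y\<close> given the random variable \<open>Z\<close> with values in \<open>N\<close>: a probability kernel that, together
  with the law of \<open>Z\<close>, determines the joint law of \<open>(Z, Y)\<close>. Any two versions agree
  almost surely with respect to the law of \<open>Z\<close>.\<close>
definition regular_cond_distr ::
  "'a measure \<Rightarrow> 'b measure \<Rightarrow> ('a \<Rightarrow> 'b) \<Rightarrow> ('a \<Rightarrow> real) \<Rightarrow> ('b \<Rightarrow> real measure) \<Rightarrow> bool" where
  "regular_cond_distr M N Z Y K \<longleftrightarrow>
     K \<in> N \<rightarrow>\<^sub>M prob_algebra borel \<and>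
     (\<forall>A\<in>sets N. \<forall>B\<in>sets borel.
        emeasure M {\<omega> \<in> space M. Z \<omega> \<in> A \<and> Y \<omega> \<in> B}
          = (\<integral>\<^sup>+z\<in>A. emeasure (K z) B \<partial>distr M N Z))"

end

theory Submission
  imports Defs
begin

text \<open>
  Let \<open>Z = m(X; \<beta>\<^sub>0)\<close>. Comparing \<open>Z\<close> with its translates at a suitable threshold shows that
  \<open>E (1{l \<le> Z < u} V(u, Y)) \<ge> 0\<close> and \<open>E (1{l \<le> Z < u} V(l, Y)) \<le> 0\<close> for all short intervals
  \<open>[l, u)\<close>. By monotonicity of \<open>V\<close> the first inequality persists for \<open>V(Z + c, Y)\<close> whenever
  \<open>u - l \<le> c\<close>, and the second for \<open>V(Z - c, Y)\<close>. Short half-open intervals determine the sign of a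
  density, so conditioning on \<open>Z\<close> gives \<open>Vbar(Z - c) \<le> 0 \<le> Vbar(Z + c)\<close> almost surely, and
  \<open>c\<close> tends to 0 along a sequence.
\<close>

section \<open>Disintegration of expectations along a regular conditional distribution\<close>

text \<open>Both sides integrate \<open>h\<close> against a measure on the product space: the joint
  law of \<open>(Z, Y)\<close> on the left, the law of \<open>Z\<close> composed with the kernel on
  the right. By \<open>regular_cond_distr\<close> the two agree on rectangles, which form an
  intersection-stable generator.\<close>

lemma nn_integral_regular_cond_distr:
  assumes "prob_space M" and Z[measurable]: "Z \<in> M \<rightarrow>\<^sub>M N"
    and Y[measurable]: "Y \<in> borel_measurable M"
    and rcd: "regular_cond_distr M N Z Y K"
    and h[measurable]: "(\<lambda>(z, y). h z y) \<in> borel_measurable (N \<Otimes>\<^sub>M borel)"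
  shows "(\<integral>\<^sup>+\<omega>. h (Z \<omega>) (Y \<omega>) \<partial>M) = (\<integral>\<^sup>+z. (\<integral>\<^sup>+y. h z y \<partial>K z) \<partial>distr M N Z)"
proof -
  interpret prob_space M by fact
  have K[measurable]: "K \<in> N \<rightarrow>\<^sub>M prob_algebra borel"
    and emK: "\<And>A B. A \<in> sets N \<Longrightarrow> B \<in> sets borel \<Longrightarrow>
        emeasure M {\<omega> \<in> space M. Z \<omega> \<in> A \<and> Y \<omega> \<in> B}
          = (\<integral>\<^sup>+z\<in>A. emeasure (K z) B \<partial>distr M N Z)"
    using rcd by (auto simp: regular_cond_distr_def)
  have sK: "sets (K z) = sets borel" if "z \<in> space N" for z
    using measurable_space[OF K that] by (simp add: space_prob_algebra)
  define P where "P = N \<Otimes>\<^sub>M (borel :: real measure)"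
  define D where "D = distr M P (\<lambda>\<omega>. (Z \<omega>, Y \<omega>))"
  \<comment> \<open>\<open>R z\<close> places \<open>K z\<close> on the slice over \<open>z\<close>,
    so \<open>B\<close> is the law of a pair obtained by drawing \<open>z\<close> from the law of
    \<open>Z\<close> and then \<open>y\<close> from \<open>K z\<close>.\<close>
  define R where "R z = distr (K z) P (Pair z)" for z
  define B where "B = distr M N Z \<bind> R"
  have R: "R \<in> N \<rightarrow>\<^sub>M prob_algebra P"
    unfolding R_def P_def by (rule measurable_distr_prob_space2[OF K]) simp
  have Rs: "R \<in> distr M N Z \<rightarrow>\<^sub>M subprob_algebra P"
    using measurable_prob_algebraD[OF R] by simp
  have ne: "space (distr M N Z) \<noteq> {}"
    using not_empty measurable_space[OF Z] by auto
  have "D = B"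
  proof (rule measure_eqI_generator_eq[OF Int_stable_pair_measure_generator])
    let ?\<Omega> = "space N \<times> space (borel :: real measure)"
    let ?E = "{a \<times> b |a b. a \<in> sets N \<and> b \<in> sets (borel :: real measure)}"
    show "?E \<subseteq> Pow ?\<Omega>"
      by (rule pair_measure_closed)
    show "sets D = sigma_sets ?\<Omega> ?E"
      by (simp add: D_def P_def sets_pair_measure)
    have "sets B = sets P"
      unfolding B_def by (rule sets_bind[OF _ ne]) (simp add: R_def)
    then show "sets B = sigma_sets ?\<Omega> ?E"
      by (simp add: P_def sets_pair_measure)
    show "range (\<lambda>i::nat. ?\<Omega>) \<subseteq> ?E" by (use sets.top in blast)
    show "(\<Union>i::nat. ?\<Omega>) = ?\<Omega>" by simp
    have "prob_space D"
      unfolding D_def P_def by (rule prob_space_distr) simp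
    then show "emeasure D ?\<Omega> \<noteq> \<infinity>" for i :: nat
      by (metis ennreal_top_neq_one finite_measure.emeasure_finite infinity_ennreal_def prob_space_def)
    fix W assume "W \<in> ?E"
    then obtain a b where W: "W = a \<times> b" and [measurable]: "a \<in> sets N" "b \<in> sets borel" by auto
    have "emeasure D W = emeasure M {\<omega> \<in> space M. Z \<omega> \<in> a \<and> Y \<omega> \<in> b}"
      unfolding D_def W P_def by (subst emeasure_distr) (auto intro!: arg_cong[where f="emeasure M"])
    also have "\<dots> = (\<integral>\<^sup>+z\<in>a. emeasure (K z) b \<partial>distr M N Z)"
      by (rule emK) simp_all
    also have "\<dots> = (\<integral>\<^sup>+z. emeasure (R z) W \<partial>distr M N Z)"
    proof (rule nn_integral_cong)
      fix z assume "z \<in> space (distr M N Z)"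
      then have z: "z \<in> space N" by simp
      have "emeasure (R z) W = emeasure (K z) (Pair z -` W \<inter> space (K z))"
        unfolding R_def P_def W using z sK[OF z]
        by (subst emeasure_distr) (auto simp: measurable_cong_sets[OF sK[OF z] refl])
      also have "Pair z -` W \<inter> space (K z) = (if z \<in> a then b else {})"
        using sets_eq_imp_space_eq[OF sK[OF z]] by (auto simp: W)
      finally show "emeasure (K z) b * indicator a z = emeasure (R z) W" by simp
    qed
    also have "\<dots> = emeasure B W"
      unfolding B_def by (rule emeasure_bind[OF ne Rs, symmetric]) (simp add: W P_def)
    finally show "emeasure D W = emeasure B W" .
  qed
  have hP: "(\<lambda>(z, y). h z y) \<in> borel_measurable P"
    by (simp add: P_def)
  have "(\<integral>\<^sup>+\<omega>. h (Z \<omega>) (Y \<omega>) \<partial>M) = (\<integral>\<^sup>+(z, y). h z y \<partial>D)"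
    unfolding D_def using hP by (subst nn_integral_distr) (auto simp: P_def)
  also have "\<dots> = (\<integral>\<^sup>+z. (\<integral>\<^sup>+(z, y). h z y \<partial>R z) \<partial>distr M N Z)"
    unfolding \<open>D = B\<close> B_def by (rule nn_integral_bind[OF hP Rs])
  also have "\<dots> = (\<integral>\<^sup>+z. (\<integral>\<^sup>+y. h z y \<partial>K z) \<partial>distr M N Z)"
  proof (rule nn_integral_cong)
    fix z assume "z \<in> space (distr M N Z)"
    then have z: "z \<in> space N" by simp
    then show "(\<integral>\<^sup>+(z, y). h z y \<partial>R z) = (\<integral>\<^sup>+y. h z y \<partial>K z)"
      unfolding R_def using hP
      by (subst nn_integral_distr) (auto simp: P_def measurable_cong_sets[OF sK[OF z] refl])
  qed
  finally show ?thesis .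
qed

text \<open>The nonnegative version is applied to the positive and the negative part of
  \<open>h\<close>. Both have finite total mass, so the inner integrals are genuine for almost every
  \<open>z\<close>.\<close>

lemma integral_regular_cond_distr:
  fixes h :: "'b \<Rightarrow> real \<Rightarrow> real"
  assumes M: "prob_space M" and Z[measurable]: "Z \<in> M \<rightarrow>\<^sub>M N"
    and Y[measurable]: "Y \<in> borel_measurable M"
    and rcd: "regular_cond_distr M N Z Y K"
    and h[measurable]: "(\<lambda>(z, y). h z y) \<in> borel_measurable (N \<Otimes>\<^sub>M borel)"
    and int: "integrable M (\<lambda>\<omega>. h (Z \<omega>) (Y \<omega>))"
  shows "integrable (distr M N Z) (\<lambda>z. \<integral>y. h z y \<partial>K z)" (is ?integrable)
    and "(\<integral>\<omega>. h (Z \<omega>) (Y \<omega>) \<partial>M) = (\<integral>z. (\<integral>y. h z y \<partial>K z) \<partial>distr M N Z)" (is ?integral)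
proof -
  have K: "K \<in> N \<rightarrow>\<^sub>M prob_algebra borel"
    using rcd by (simp add: regular_cond_distr_def)
  note [measurable] = measurable_prob_algebraD[OF K]
  have sK: "sets (K z) = sets borel" if "z \<in> space N" for z
    using measurable_space[OF K that] by (simp add: space_prob_algebra)
  define Ip In where "Ip z = (\<integral>\<^sup>+y. ennreal (h z y) \<partial>K z)"
    and "In z = (\<integral>\<^sup>+y. ennreal (- h z y) \<partial>K z)" for z
  have [measurable]: "Ip \<in> borel_measurable N" "In \<in> borel_measurable N"
    unfolding Ip_def In_def by (rule nn_integral_measurable_subprob_algebra2[of _ _ borel]; simp)+
  have p: "(\<integral>\<^sup>+\<omega>. ennreal (h (Z \<omega>) (Y \<omega>)) \<partial>M) = (\<integral>\<^sup>+z. Ip z \<partial>distr M N Z)"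
    unfolding Ip_def by (rule nn_integral_regular_cond_distr[OF M Z Y rcd]) simp
  have n: "(\<integral>\<^sup>+\<omega>. ennreal (- h (Z \<omega>) (Y \<omega>)) \<partial>M) = (\<integral>\<^sup>+z. In z \<partial>distr M N Z)"
    unfolding In_def by (rule nn_integral_regular_cond_distr[OF M Z Y rcd]) simp
  have fin: "(\<integral>\<^sup>+z. Ip z \<partial>distr M N Z) \<noteq> \<infinity>" "(\<integral>\<^sup>+z. In z \<partial>distr M N Z) \<noteq> \<infinity>"
    using int unfolding p[symmetric] n[symmetric] by (auto simp: real_integrable_def)
  have AEfin: "AE z in distr M N Z. Ip z \<noteq> \<infinity>" "AE z in distr M N Z. In z \<noteq> \<infinity>"
    by (rule nn_integral_PInf_AE[OF _ fin(1)] nn_integral_PInf_AE[OF _ fin(2)]; simp)+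
  \<comment> \<open>Only where \<open>Ip z\<close> or \<open>In z\<close> is infinite does the inner
    Bochner integral take its default value 0; this happens on a null set.\<close>
  have eq: "AE z in distr M N Z. (\<integral>y. h z y \<partial>K z) = enn2real (Ip z) - enn2real (In z)"
    using AEfin AE_space
  proof eventually_elim
    case (elim z)
    then have z: "z \<in> space N" by simp
    have "h z \<in> borel_measurable (K z)"
      using z by (simp add: measurable_cong_sets[OF sK[OF z] refl])
    then have "integrable (K z) (h z)"
      using elim by (simp add: real_integrable_def Ip_def In_def)
    then show ?case
      by (simp add: real_lebesgue_integral_def Ip_def In_def)
  qed
  \<comment> \<open>\<open>enn2real\<close> sends infinity to 0, which is harmless because a
    function with finite integral is finite almost everywhere.\<close>
  have enn: "integrable (distr M N Z) (\<lambda>z. enn2real (I z))"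
      "(\<integral>z. enn2real (I z) \<partial>distr M N Z) = enn2real (\<integral>\<^sup>+z. I z \<partial>distr M N Z)"
    if [measurable]: "I \<in> borel_measurable N" and f: "(\<integral>\<^sup>+z. I z \<partial>distr M N Z) \<noteq> \<infinity>" for I
  proof -
    have "AE z in distr M N Z. I z \<noteq> \<infinity>"
      by (rule nn_integral_PInf_AE[OF _ f]) simp
    then have e: "(\<integral>\<^sup>+z. ennreal (enn2real (I z)) \<partial>distr M N Z) = (\<integral>\<^sup>+z. I z \<partial>distr M N Z)"
      by (intro nn_integral_cong_AE) (auto simp: less_top)
    show "integrable (distr M N Z) (\<lambda>z. enn2real (I z))"
      using f by (intro integrableI_nonneg) (auto simp: e less_top)
    show "(\<integral>z. enn2real (I z) \<partial>distr M N Z) = enn2real (\<integral>\<^sup>+z. I z \<partial>distr M N Z)"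
      by (subst integral_eq_nn_integral) (auto simp: e)
  qed
  \<comment> \<open>The integrand depends on \<open>z\<close>. Pushing \<open>K z\<close> forward
    along \<open>Pair z\<close> turns it into one fixed function on the product, integrated against
    a measurable kernel.\<close>
  have m: "(\<lambda>z. \<integral>y. h z y \<partial>K z) \<in> borel_measurable (distr M N Z)"
  proof -
    note measurable_distr2[measurable]
    have "(\<lambda>z. \<integral>w. (case w of (z, y) \<Rightarrow> h z y) \<partial>distr (K z) (N \<Otimes>\<^sub>M borel) (Pair z)) \<in> borel_measurable N"
      by measurable
    also have "?this \<longleftrightarrow> (\<lambda>z. \<integral>y. h z y \<partial>K z) \<in> borel_measurable N"
      by (intro measurable_cong, subst integral_distr)
        (auto simp: measurable_cong_sets[OF sK refl])
    finally show ?thesis by simp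
  qed
  show ?integrable
    by (rule integrable_cong_AE_imp[OF Bochner_Integration.integrable_diff[OF enn(1) enn(1)] m AE_symmetric[OF eq]])
       (use fin in auto)
  have "(\<integral>\<omega>. h (Z \<omega>) (Y \<omega>) \<partial>M)
      = enn2real (\<integral>\<^sup>+z. Ip z \<partial>distr M N Z) - enn2real (\<integral>\<^sup>+z. In z \<partial>distr M N Z)"
    unfolding p[symmetric] n[symmetric] by (rule real_lebesgue_integral_def[OF int])
  also have "\<dots> = (\<integral>z. enn2real (Ip z) - enn2real (In z) \<partial>distr M N Z)"
    using fin by (simp add: enn)
  also have "\<dots> = (\<integral>z. (\<integral>y. h z y \<partial>K z) \<partial>distr M N Z)"
    using eq m by (intro integral_cong_AE) auto
  finally show ?integral .
qed

section \<open>The sign of a density from its integrals over short intervals\<close>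

text \<open>Half-open cells tile the line without overlap, so atoms of \<open>M\<close> need no
  separate treatment, and the bound \<open>\<delta>\<close> on the length costs nothing because the
  tiling may be taken arbitrarily fine.\<close>

lemma AE_nonneg_if_short_intervals:
  fixes f :: "real \<Rightarrow> real"
  assumes "finite_measure M" and sM[measurable_cong]: "sets M = sets borel"
    and f[measurable]: "integrable M f" and "\<delta> > 0"
    and ivl: "\<And>l u. l < u \<Longrightarrow> u \<le> l + \<delta> \<Longrightarrow> 0 \<le> (LINT x:{l..<u}|M. f x)"
  shows "AE x in M. 0 \<le> f x"
proof -
  interpret finite_measure M by fact
  have [simp]: "space M = UNIV"
    using sets_eq_imp_space_eq[OF sM] by simp
  have set_int: "set_integrable M A f" if "A \<in> sets borel" for A
    unfolding set_integrable_def using integrable_mult_indicator[OF _ f, of A] that by (simp add: sM)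
  \<comment> \<open>A compact set is the limit of the finite unions \<open>D n\<close> of grid cells of width \<open>1 / n\<close> meeting it;
    inner regularity then rules out a non-null set on which \<open>f\<close> is negative.\<close>
  have compact: "0 \<le> (LINT x:C|M. f x)" if C: "compact C" for C
  proof -
    define D where "D n = {x. \<exists>c\<in>C. \<lfloor>real n * x\<rfloor> = \<lfloor>real n * c\<rfloor>}" for n
    define J where "J n = (\<lambda>c. \<lfloor>real n * c\<rfloor>) ` C" for n
    define I where "I n k = {of_int k / real n ..< (of_int k + 1) / real n}" for n and k :: int
    obtain b where b: "\<And>c. c \<in> C \<Longrightarrow> \<bar>c\<bar> \<le> b"
      using compact_imp_bounded[OF C] by (auto simp: bounded_iff)
    \<comment> \<open>\<open>C\<close> is bounded, so only finitely many cells meet it.\<close>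
    have finJ: "finite (J n)" for n
    proof (rule finite_subset)
      show "J n \<subseteq> {\<lfloor>- (real n * b)\<rfloor>..\<lfloor>real n * b\<rfloor>}"
      proof
        fix k assume "k \<in> J n"
        then obtain c where c: "c \<in> C" "k = \<lfloor>real n * c\<rfloor>" by (auto simp: J_def)
        have "- b \<le> c" "c \<le> b" using b[OF c(1)] by auto
        then have "- (real n * b) \<le> real n * c" "real n * c \<le> real n * b"
          using mult_left_mono[of "- b" c "real n"] by (auto intro: mult_left_mono)
        then show "k \<in> {\<lfloor>- (real n * b)\<rfloor>..\<lfloor>real n * b\<rfloor>}"
          using c(2) floor_mono by auto
      qed
    qed simp
    \<comment> \<open>The case \<open>n = 0\<close> is excluded: division by zero makes
      \<open>I 0 k\<close> empty, whereas the floor of \<open>0 * x\<close> is 0 for every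
      \<open>x\<close>. This is why the limit below runs over \<open>D (Suc n)\<close>.\<close>
    have I_iff: "x \<in> I n k \<longleftrightarrow> \<lfloor>real n * x\<rfloor> = k" if "n > 0" for x n k
      using that unfolding I_def by (auto simp: floor_eq_iff field_simps)
    have D_eq: "D n = (\<Union>k\<in>J n. I n k)" if "n > 0" for n
      using I_iff[OF that] by (auto simp: D_def J_def)
    have D_sets[measurable]: "D n \<in> sets borel" if "n > 0" for n
      unfolding D_eq[OF that] I_def using finJ by (intro sets.finite_UN) auto
    have D_nonneg: "0 \<le> (LINT x:D n|M. f x)" if n: "n > 0" "1 / real n \<le> \<delta>" for n
    proof -
      have "(LINT x:D n|M. f x) = (\<Sum>k\<in>J n. LINT x:I n k|M. f x)"
        unfolding D_eq[OF n(1)]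
      proof (rule set_integral_finite_Union[OF finJ])
        show "disjoint_family_on (I n) (J n)"
          using I_iff[OF n(1)] by (auto simp: disjoint_family_on_def)
      qed (auto simp: I_def sM intro!: set_int)
      also have "\<dots> \<ge> 0"
        unfolding I_def by (intro sum_nonneg ivl) (use n in \<open>auto simp: divide_simps\<close>)
      finally show ?thesis .
    qed
    have Cb[measurable]: "C \<in> sets borel"
      using C by (simp add: borel_compact)
    have lim: "(\<lambda>n. indicator (D (Suc n)) x *\<^sub>R f x) \<longlonglongrightarrow> indicator C x *\<^sub>R f x" for x
    proof (cases "x \<in> C")
      case True
      then have "x \<in> D n" for n by (auto simp: D_def)
      with True show ?thesis by simp
    next
      case False
      have "open (- C)" using compact_imp_closed[OF C] by auto
      then obtain e where e: "e > 0" "ball x e \<subseteq> - C"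
        using False openE by blast
      have "eventually (\<lambda>n. 1 / real (Suc n) < e) sequentially"
        using order_tendstoD(2)[OF LIMSEQ_inverse_real_of_nat e(1)] by (simp add: inverse_eq_divide)
      then have "eventually (\<lambda>n. x \<notin> D (Suc n)) sequentially"
      proof eventually_elim
        case (elim n)
        show ?case
        proof
          assume "x \<in> D (Suc n)"
          then obtain c where c: "c \<in> C" "\<lfloor>real (Suc n) * x\<rfloor> = \<lfloor>real (Suc n) * c\<rfloor>"
            by (auto simp: D_def)
          then have "\<bar>real (Suc n) * x - real (Suc n) * c\<bar> < 1" by linarith
          then have "real (Suc n) * \<bar>x - c\<bar> < 1"
            by (metis abs_mult abs_of_nat right_diff_distrib)
          then have "\<bar>x - c\<bar> < 1 / real (Suc n)" by (simp add: field_simps)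
          then have "c \<in> ball x e" using elim by (simp add: dist_real_def)
          then show False using e c by auto
        qed
      qed
      then show ?thesis
        using False by (intro tendsto_eventually) (auto elim: eventually_mono)
    qed
    have "(\<lambda>n. LINT x:D (Suc n)|M. f x) \<longlonglongrightarrow> (LINT x:C|M. f x)"
      unfolding set_lebesgue_integral_def
    proof (rule integral_dominated_convergence[where w="\<lambda>x. \<bar>f x\<bar>"])
      show "AE x in M. (\<lambda>n. indicator (D (Suc n)) x *\<^sub>R f x) \<longlonglongrightarrow> indicator C x *\<^sub>R f x"
        using lim by simp
    qed (use f in \<open>auto split: split_indicator\<close>)
    moreover have "eventually (\<lambda>n. 1 / real (Suc n) < \<delta>) sequentially"
      using order_tendstoD(2)[OF LIMSEQ_inverse_real_of_nat \<open>\<delta> > 0\<close>] by (simp add: inverse_eq_divide)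
    then have "eventually (\<lambda>n. 0 \<le> (LINT x:D (Suc n)|M. f x)) sequentially"
      by eventually_elim (auto intro!: D_nonneg)
    ultimately show ?thesis
      by (rule tendsto_lowerbound) simp
  qed
  define A where "A = {x. f x < 0}"
  have A: "A \<in> sets borel"
    unfolding A_def using f by (simp add: sM[symmetric] borel_measurable_integrable)
  \<comment> \<open>On \<open>C\<close> the function \<open>- f\<close> is strictly positive, yet
    its integral over \<open>C\<close> is at most 0 by \<open>compact\<close>. It therefore vanishes
    almost everywhere on \<open>C\<close>, which forces \<open>C\<close> to be null.\<close>
  have null: "emeasure M C = 0" if C: "compact C" "C \<subseteq> A" for C
  proof -
    have Cb: "C \<in> sets M"
      using C by (simp add: borel_compact sM)
    have i: "integrable M (\<lambda>x. indicator C x *\<^sub>R - f x)"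
      using integrable_mult_indicator[OF Cb, of "\<lambda>x. - f x"] f by simp
    have "AE x in M. 0 \<le> indicator C x *\<^sub>R - f x"
      using C by (auto simp: A_def split: split_indicator intro!: less_imp_le)
    moreover have "(\<integral>x. indicator C x *\<^sub>R - f x \<partial>M) \<le> 0"
      using compact[OF C(1)] by (simp add: set_lebesgue_integral_def)
    ultimately have "(\<integral>x. indicator C x *\<^sub>R - f x \<partial>M) = 0"
      by (intro antisym integral_nonneg_AE)
    then have "AE x in M. indicator C x *\<^sub>R - f x = 0"
      using integral_nonneg_eq_0_iff_AE[OF i] \<open>AE x in M. 0 \<le> indicator C x *\<^sub>R - f x\<close> by simp
    then have "AE x in M. x \<notin> C"
      by eventually_elim (use C in \<open>auto simp: A_def split: split_indicator_asm\<close>)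
    then show ?thesis
      using AE_iff_null_sets[OF Cb] by auto
  qed
  have "emeasure M A = (SUP K \<in> {K. K \<subseteq> A \<and> compact K}. emeasure M K)"
    by (rule inner_regular[OF sM _ A]) (simp add: emeasure_eq_measure)
  also have "\<dots> = 0"
    using null by (auto intro!: antisym SUP_least)
  finally have "A \<in> null_sets M"
    using A by (auto simp: sM)
  then have "AE x in M. x \<notin> A"
    by (rule AE_not_in)
  then show ?thesis
    by eventually_elim (simp add: A_def)
qed

section \<open>Joint measurability of identification functions\<close>

text \<open>By left-continuity, \<open>a < V z y\<close> already holds at some rational
  \<open>q < z\<close>, and monotonicity gives the converse. Superlevel sets are thus countable
  unions of measurable rectangles.\<close>

lemma identification_function_measurable_pair:
  assumes V: "identification_function V" and Vm[measurable]: "\<And>z. V z \<in> borel_measurable borel"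
  shows "(\<lambda>(z, y). V z y) \<in> borel_measurable (borel \<Otimes>\<^sub>M borel)"
proof (rule borel_measurable_iff_greater[THEN iffD2], rule allI)
  fix a
  have iff: "a < V z y \<longleftrightarrow> (\<exists>q\<in>\<rat>. q < z \<and> a < V q y)" for z y
  proof
    assume a: "a < V z y"
    have "((\<lambda>z. V z y) \<longlongrightarrow> V z y) (at_left z)"
      using V by (simp add: identification_function_def continuous_within)
    from order_tendstoD(1)[OF this a] obtain b where b: "b < z" "\<And>q. b < q \<Longrightarrow> q < z \<Longrightarrow> a < V q y"
      by (auto simp: eventually_at_left_field)
    obtain q where "q \<in> \<rat>" "b < q" "q < z"
      using Rats_dense_in_real[OF b(1)] by auto
    with b show "\<exists>q\<in>\<rat>. q < z \<and> a < V q y" by auto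
  next
    assume "\<exists>q\<in>\<rat>. q < z \<and> a < V q y"
    then obtain q where "q < z" "a < V q y" by auto
    moreover have "mono (\<lambda>z. V z y)"
      using V by (simp add: identification_function_def)
    ultimately show "a < V z y"
      using monoD[of "\<lambda>z. V z y" q z] by simp
  qed
  have "{w \<in> space (borel \<Otimes>\<^sub>M borel). a < (case w of (z, y) \<Rightarrow> V z y)}
      = (\<Union>q\<in>\<rat>. {q<..} \<times> {y. a < V q y})"
  proof (rule set_eqI, clarify)
    fix z y :: real
    show "(z, y) \<in> {w \<in> space (borel \<Otimes>\<^sub>M borel). a < (case w of (z, y) \<Rightarrow> V z y)}
        \<longleftrightarrow> (z, y) \<in> (\<Union>q\<in>\<rat>. {q<..} \<times> {y. a < V q y})"
      by (simp add: space_pair_measure iff[of z y])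
  qed
  also have "\<dots> \<in> sets (borel \<Otimes>\<^sub>M borel)"
    by (intro sets.countable_UN' countable_rat) auto
  finally show "{w \<in> space (borel \<Otimes>\<^sub>M borel). a < (case w of (z, y) \<Rightarrow> V z y)} \<in> sets (borel \<Otimes>\<^sub>M borel)" .
qed

section \<open>Conditional signs from localized expectations\<close>

text \<open>The indicator depends on \<open>Z\<close> alone and leaves the inner integral. Each
  assumed expectation is therefore the integral over \<open>[l, u)\<close> of the conditional
  integral against the law of \<open>Z\<close>, and the short-interval criterion applies.\<close>

lemma AE_cond_integral_nonneg:
  fixes Z :: "'a \<Rightarrow> real" and h :: "real \<Rightarrow> real \<Rightarrow> real"
  assumes M: "prob_space M" and Z[measurable]: "Z \<in> borel_measurable M"
    and Y[measurable]: "Y \<in> borel_measurable M"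
    and rcd: "regular_cond_distr M borel Z Y K"
    and h[measurable]: "(\<lambda>(z, y). h z y) \<in> borel_measurable (borel \<Otimes>\<^sub>M borel)"
    and int: "integrable M (\<lambda>\<omega>. h (Z \<omega>) (Y \<omega>))" and "\<delta> > 0"
    and ivl: "\<And>l u. l < u \<Longrightarrow> u \<le> l + \<delta> \<Longrightarrow>
        0 \<le> (\<integral>\<omega>. indicator {l..<u} (Z \<omega>) * h (Z \<omega>) (Y \<omega>) \<partial>M)"
  shows "AE \<omega> in M. 0 \<le> (\<integral>y. h (Z \<omega>) y \<partial>K (Z \<omega>))"
proof -
  interpret prob_space M by fact
  have "AE z in distr M borel Z. 0 \<le> (\<integral>y. h z y \<partial>K z)"
  proof (rule AE_nonneg_if_short_intervals[OF _ _ _ \<open>\<delta> > 0\<close>])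
    show "finite_measure (distr M borel Z)"
      by (rule finite_measure_distr) simp
    show "integrable (distr M borel Z) (\<lambda>z. \<integral>y. h z y \<partial>K z)"
      by (rule integral_regular_cond_distr(1)[OF M Z Y rcd h int])
    fix l u :: real assume lu: "l < u" "u \<le> l + \<delta>"
    have "integrable M (\<lambda>\<omega>. indicator (Z -` {l..<u} \<inter> space M) \<omega> *\<^sub>R h (Z \<omega>) (Y \<omega>))"
      by (rule integrable_mult_indicator[OF _ int]) simp
    then have i: "integrable M (\<lambda>\<omega>. indicator {l..<u} (Z \<omega>) * h (Z \<omega>) (Y \<omega>))"
      by (rule Bochner_Integration.integrable_cong[THEN iffD1, rotated 2])
        (auto split: split_indicator)
    have "(\<integral>\<omega>. indicator {l..<u} (Z \<omega>) * h (Z \<omega>) (Y \<omega>) \<partial>M)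
        = (\<integral>z. (\<integral>y. indicator {l..<u} z * h z y \<partial>K z) \<partial>distr M borel Z)"
      by (rule integral_regular_cond_distr(2)[OF M Z Y rcd _ i]) simp
    then show "0 \<le> (LINT z:{l..<u}|distr M borel Z. \<integral>y. h z y \<partial>K z)"
      using ivl[OF lu] by (simp add: set_lebesgue_integral_def)
  qed simp
  then show ?thesis
    by (rule AE_distrD[OF Z])
qed

theorem theorem3p2:
  fixes M :: "'a measure" and N :: "'x measure"
    and X :: "'a \<Rightarrow> 'x" and Y :: "'a \<Rightarrow> real"
    and V :: "real \<Rightarrow> real \<Rightarrow> real"
    and \<Theta> :: "'b set" and m :: "'x \<Rightarrow> 'b \<Rightarrow> real" and \<beta>\<^sub>0 :: 'b
    and \<epsilon> \<epsilon>' :: real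
    and \<kappa> :: "'x \<Rightarrow> real measure" and K :: "real \<Rightarrow> real measure"
  assumes "prob_space M"
    and "X \<in> M \<rightarrow>\<^sub>M N" and "Y \<in> borel_measurable M"
    and "identification_function V"
    and "\<And>z. V z \<in> borel_measurable borel"
    and "\<And>\<beta>. \<beta> \<in> \<Theta> \<Longrightarrow> (\<lambda>x. m x \<beta>) \<in> borel_measurable N"
    and "regular_cond_distr M N X Y \<kappa>"
    and "\<And>x. x \<in> space N \<Longrightarrow> \<kappa> x \<in> id_class V"
    and "\<And>\<beta> \<eta>. \<beta> \<in> \<Theta> \<Longrightarrow> integrable M (\<lambda>\<omega>. elementary_loss V \<eta> (m (X \<omega>) \<beta>) (Y \<omega>))"
    and "\<epsilon> > 0"
    and "\<And>\<beta> a. \<beta> \<in> \<Theta> \<Longrightarrow> a \<in> {-\<epsilon><..<\<epsilon>} \<Longrightarrow>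
           \<exists>\<beta>'\<in>\<Theta>. \<forall>x\<in>space N. m x \<beta> + a = m x \<beta>'"
    and "\<beta>\<^sub>0 \<in> \<Theta>"
    and "\<And>\<eta>. (INF \<beta>\<in>\<Theta>. ereal (\<integral>\<omega>. elementary_loss V \<eta> (m (X \<omega>) \<beta>) (Y \<omega>) \<partial>M))
               = ereal (\<integral>\<omega>. elementary_loss V \<eta> (m (X \<omega>) \<beta>\<^sub>0) (Y \<omega>) \<partial>M)"
    and "\<epsilon>' > 0"
    and "integrable M (\<lambda>\<omega>. V (m (X \<omega>) \<beta>\<^sub>0 + \<epsilon>') (Y \<omega>))"
    and "integrable M (\<lambda>\<omega>. V (m (X \<omega>) \<beta>\<^sub>0 - \<epsilon>') (Y \<omega>))"
    and "regular_cond_distr M borel (\<lambda>\<omega>. m (X \<omega>) \<beta>\<^sub>0) Y K"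
    and "AE \<omega> in M. K (m (X \<omega>) \<beta>\<^sub>0) \<in> id_class V"
  shows "AE \<omega> in M. ereal (m (X \<omega>) \<beta>\<^sub>0) \<in> induced_functional V (K (m (X \<omega>) \<beta>\<^sub>0))"
proof -
  interpret prob_space M by fact
  note X[measurable] = assms(2) and Y[measurable] = assms(3) and Vid = assms(4)
    and Vm[measurable] = assms(5) and mm = assms(6) and loss_int = assms(9)
    and \<epsilon> = assms(10) and shift = assms(11) and \<beta>\<^sub>0 = assms(12) and opt = assms(13)
    and \<epsilon>' = assms(14) and int_up = assms(15) and int_dn = assms(16) and rcd = assms(17)
  define Z where "Z \<omega> = m (X \<omega>) \<beta>\<^sub>0" for \<omega>
  have [measurable]: "Z \<in> borel_measurable M"
    unfolding Z_def using measurable_compose[OF X mm[OF \<beta>\<^sub>0]] .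
  have rcd_Z: "regular_cond_distr M borel Z Y K"
    using rcd by (simp add: Z_def[abs_def])
  have mono: "V z y \<le> V z' y" if "z \<le> z'" for z z' y
    using Vid that by (auto simp: identification_function_def mono_def)
  have Vpair[measurable]: "(\<lambda>(z, y). V z y) \<in> borel_measurable (borel \<Otimes>\<^sub>M borel)"
    by (rule identification_function_measurable_pair[OF Vid Vm])

  \<comment> \<open>Optimality of the model against its translates\<close>
  have translate: "integrable M (\<lambda>\<omega>. elementary_loss V \<eta> (Z \<omega> + a) (Y \<omega>))"
      "(\<integral>\<omega>. elementary_loss V \<eta> (Z \<omega>) (Y \<omega>) \<partial>M)
        \<le> (\<integral>\<omega>. elementary_loss V \<eta> (Z \<omega> + a) (Y \<omega>) \<partial>M)"
    if a: "\<bar>a\<bar> < \<epsilon>" for a \<eta>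
  proof -
    have "a \<in> {-\<epsilon><..<\<epsilon>}" using a by auto
    then obtain \<beta>' where \<beta>': "\<beta>' \<in> \<Theta>" and "\<forall>x\<in>space N. m x \<beta>\<^sub>0 + a = m x \<beta>'"
      using shift[OF \<beta>\<^sub>0] by blast
    then have eq: "Z \<omega> + a = m (X \<omega>) \<beta>'" if "\<omega> \<in> space M" for \<omega>
      using measurable_space[OF X that] by (simp add: Z_def)
    show "integrable M (\<lambda>\<omega>. elementary_loss V \<eta> (Z \<omega> + a) (Y \<omega>))"
      using loss_int[OF \<beta>', of \<eta>]
      by (rule Bochner_Integration.integrable_cong[THEN iffD1, rotated 2]) (simp_all add: eq)
    have "ereal (\<integral>\<omega>. elementary_loss V \<eta> (Z \<omega>) (Y \<omega>) \<partial>M)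
        \<le> ereal (\<integral>\<omega>. elementary_loss V \<eta> (m (X \<omega>) \<beta>') (Y \<omega>) \<partial>M)"
      unfolding Z_def opt[symmetric] by (rule INF_lower[OF \<beta>'])
    also have "(\<integral>\<omega>. elementary_loss V \<eta> (m (X \<omega>) \<beta>') (Y \<omega>) \<partial>M)
        = (\<integral>\<omega>. elementary_loss V \<eta> (Z \<omega> + a) (Y \<omega>) \<partial>M)"
      by (rule Bochner_Integration.integral_cong) (simp_all add: eq)
    finally show "(\<integral>\<omega>. elementary_loss V \<eta> (Z \<omega>) (Y \<omega>) \<partial>M)
        \<le> (\<integral>\<omega>. elementary_loss V \<eta> (Z \<omega> + a) (Y \<omega>) \<partial>M)" by simp
  qed
  have loss_int0: "integrable M (\<lambda>\<omega>. elementary_loss V \<eta> (Z \<omega>) (Y \<omega>))" for \<eta>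
    using loss_int[OF \<beta>\<^sub>0] by (simp add: Z_def)
  \<comment> \<open>Translating the optimal model by \<open>a\<close> only changes the elementary loss where the threshold
    \<open>\<eta>\<close> lies between \<open>Z\<close> and \<open>Z + a\<close>; choosing \<open>\<eta>\<close> as an endpoint of an interval and \<open>\<bar>a\<bar>\<close> as its
    length turns this into the event that \<open>Z\<close> lies in the interval.\<close>
  have up: "integrable M (\<lambda>\<omega>. indicator {l..<u} (Z \<omega>) * V u (Y \<omega>))"
      "0 \<le> (\<integral>\<omega>. indicator {l..<u} (Z \<omega>) * V u (Y \<omega>) \<partial>M)"
    if lu: "l < u" "u - l < \<epsilon>" for l u
  proof -
    \<comment> \<open>The indicator of \<open>u \<le> Y\<close> cancels in the difference, and
      \<open>u \<le> Z + (u - l)\<close> means \<open>l \<le> Z\<close>.\<close>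
    have eq: "elementary_loss V u (Z \<omega> + (u - l)) (Y \<omega>) - elementary_loss V u (Z \<omega>) (Y \<omega>)
        = indicator {l..<u} (Z \<omega>) * V u (Y \<omega>)" for \<omega>
      using lu by (auto simp: elementary_loss_def split: split_indicator)
    have a: "\<bar>u - l\<bar> < \<epsilon>" using lu by simp
    note int = translate(1)[OF a, of u]
    show "integrable M (\<lambda>\<omega>. indicator {l..<u} (Z \<omega>) * V u (Y \<omega>))"
      using Bochner_Integration.integrable_diff[OF int loss_int0[of u]] by (simp only: eq)
    show "0 \<le> (\<integral>\<omega>. indicator {l..<u} (Z \<omega>) * V u (Y \<omega>) \<partial>M)"
      using translate(2)[OF a, of u] Bochner_Integration.integral_diff[OF int loss_int0[of u]]
      by (simp only: eq)
  qed
  have dn: "integrable M (\<lambda>\<omega>. indicator {l..<u} (Z \<omega>) * - V l (Y \<omega>))"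
      "0 \<le> (\<integral>\<omega>. indicator {l..<u} (Z \<omega>) * - V l (Y \<omega>) \<partial>M)"
    if lu: "l < u" "u - l < \<epsilon>" for l u
  proof -
    \<comment> \<open>Here the threshold is the left endpoint and the shift goes down:
      \<open>l \<le> Z + (l - u)\<close> means \<open>u \<le> Z\<close>, so the indicator is lost on
      the same interval and the sign is negative.\<close>
    have eq: "elementary_loss V l (Z \<omega> + (l - u)) (Y \<omega>) - elementary_loss V l (Z \<omega>) (Y \<omega>)
        = indicator {l..<u} (Z \<omega>) * - V l (Y \<omega>)" for \<omega>
      using lu by (auto simp: elementary_loss_def split: split_indicator)
    have a: "\<bar>l - u\<bar> < \<epsilon>" using lu by simp
    note int = translate(1)[OF a, of l]
    show "integrable M (\<lambda>\<omega>. indicator {l..<u} (Z \<omega>) * - V l (Y \<omega>))"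
      using Bochner_Integration.integrable_diff[OF int loss_int0[of l]] by (simp only: eq)
    show "0 \<le> (\<integral>\<omega>. indicator {l..<u} (Z \<omega>) * - V l (Y \<omega>) \<partial>M)"
      using translate(2)[OF a, of l] Bochner_Integration.integral_diff[OF int loss_int0[of l]]
      by (simp only: eq)
  qed

  \<comment> \<open>Signs of the conditional expectations near \<open>Z\<close>\<close>
  \<comment> \<open>Monotonicity traps \<open>V (Z + c) Y\<close> between the two variables at
    distance \<open>\<epsilon>'\<close>, which are integrable by assumption.\<close>
  have V_int: "integrable M (\<lambda>\<omega>. V (Z \<omega> + c) (Y \<omega>))" if c: "\<bar>c\<bar> \<le> \<epsilon>'" for c
  proof (rule Bochner_Integration.integrable_bound)
    show "integrable M (\<lambda>\<omega>. \<bar>V (Z \<omega> + \<epsilon>') (Y \<omega>)\<bar> + \<bar>V (Z \<omega> - \<epsilon>') (Y \<omega>)\<bar>)"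
      using int_up int_dn by (simp add: Z_def)
    have "\<bar>V (Z \<omega> + c) (Y \<omega>)\<bar> \<le> \<bar>V (Z \<omega> + \<epsilon>') (Y \<omega>)\<bar> + \<bar>V (Z \<omega> - \<epsilon>') (Y \<omega>)\<bar>" for \<omega>
      using mono[of "Z \<omega> + c" "Z \<omega> + \<epsilon>'" "Y \<omega>"] mono[of "Z \<omega> - \<epsilon>'" "Z \<omega> + c" "Y \<omega>"] c by linarith
    then show "AE \<omega> in M. norm (V (Z \<omega> + c) (Y \<omega>))
        \<le> norm (\<bar>V (Z \<omega> + \<epsilon>') (Y \<omega>)\<bar> + \<bar>V (Z \<omega> - \<epsilon>') (Y \<omega>)\<bar>)"
      by (intro AE_I2) simp
  qed simp
  have ind_int: "integrable M (\<lambda>\<omega>. indicator {l..<u} (Z \<omega>) * h \<omega>)"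
    if "integrable M h" for l u and h :: "'a \<Rightarrow> real"
    using that
    by (rule Bochner_Integration.integrable_bound)
      (use borel_measurable_integrable[OF that] in \<open>auto split: split_indicator\<close>)
  have AE_up: "AE \<omega> in M. 0 \<le> Vbar V (Z \<omega> + c) (K (Z \<omega>))" if c: "0 < c" "c \<le> \<epsilon>'" for c
    unfolding Vbar_def
  \<comment> \<open>The bound \<open>c\<close> on the length gives
    \<open>u \<le> l + c \<le> Z + c\<close> whenever \<open>Z\<close> lies in the interval, hence
    \<open>V u Y \<le> V (Z + c) Y\<close>. The bound \<open>\<epsilon> / 2\<close> keeps the length
    strictly below \<open>\<epsilon>\<close>, as translation requires.\<close>
  proof (rule AE_cond_integral_nonneg[where h="\<lambda>z. V (z + c)" and \<delta>="min c (\<epsilon> / 2)"])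
    show "integrable M (\<lambda>\<omega>. V (Z \<omega> + c) (Y \<omega>))" using V_int c by simp
    fix l u :: real assume lu: "l < u" "u \<le> l + min c (\<epsilon> / 2)"
    then have lu': "l < u" "u - l < \<epsilon>" using \<epsilon> by auto
    have "0 \<le> (\<integral>\<omega>. indicator {l..<u} (Z \<omega>) * V u (Y \<omega>) \<partial>M)" by (rule up(2)[OF lu'])
    also have "\<dots> \<le> (\<integral>\<omega>. indicator {l..<u} (Z \<omega>) * V (Z \<omega> + c) (Y \<omega>) \<partial>M)"
      using lu c by (intro integral_mono up(1)[OF lu'] ind_int V_int) (auto split: split_indicator intro!: mono)
    finally show "0 \<le> (\<integral>\<omega>. indicator {l..<u} (Z \<omega>) * V (Z \<omega> + c) (Y \<omega>) \<partial>M)" .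
  qed (use c \<epsilon> rcd_Z \<open>prob_space M\<close> in simp_all)
  have AE_dn: "AE \<omega> in M. Vbar V (Z \<omega> - c) (K (Z \<omega>)) \<le> 0" if c: "0 < c" "c \<le> \<epsilon>'" for c
  proof -
    have "AE \<omega> in M. 0 \<le> (\<integral>y. - V (Z \<omega> - c) y \<partial>K (Z \<omega>))"
    \<comment> \<open>On the event \<open>l \<le> Z < u\<close> one has
      \<open>Z - c < u - c \<le> l\<close>, so \<open>- V l Y \<le> - V (Z - c) Y\<close>.\<close>
    proof (rule AE_cond_integral_nonneg[where h="\<lambda>z y. - V (z - c) y" and \<delta>="min c (\<epsilon> / 2)"])
      show int: "integrable M (\<lambda>\<omega>. - V (Z \<omega> - c) (Y \<omega>))" using V_int[of "- c"] c by simp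
      fix l u :: real assume lu: "l < u" "u \<le> l + min c (\<epsilon> / 2)"
      then have lu': "l < u" "u - l < \<epsilon>" using \<epsilon> by auto
      have "0 \<le> (\<integral>\<omega>. indicator {l..<u} (Z \<omega>) * - V l (Y \<omega>) \<partial>M)" by (rule dn(2)[OF lu'])
      also have "\<dots> \<le> (\<integral>\<omega>. indicator {l..<u} (Z \<omega>) * - V (Z \<omega> - c) (Y \<omega>) \<partial>M)"
        using lu c by (intro integral_mono dn(1)[OF lu'] ind_int int) (auto split: split_indicator intro!: mono)
      finally show "0 \<le> (\<integral>\<omega>. indicator {l..<u} (Z \<omega>) * - V (Z \<omega> - c) (Y \<omega>) \<partial>M)" .
    qed (use c \<epsilon> rcd_Z \<open>prob_space M\<close> in simp_all)
    then show ?thesis by (simp add: Vbar_def)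
  qed

  \<comment> \<open>Passage to the limit and the bounds of the induced interval\<close>
  \<comment> \<open>The exceptional null set depends on \<open>c\<close>; a sequence tending to 0
    leaves one null set for all its members.\<close>
  define c where "c n = \<epsilon>' / real (Suc n)" for n
  have c: "0 < c n" "c n \<le> \<epsilon>'" for n
    using \<epsilon>' by (auto simp: c_def field_simps)
  have c_small: "\<exists>n. c n < d" if "d > 0" for d
  proof -
    have "eventually (\<lambda>n. c n < d) sequentially"
      unfolding c_def using \<open>d > 0\<close> lim_const_over_n[of \<epsilon>', THEN LIMSEQ_Suc]
      by (intro order_tendstoD(2)) auto
    then show ?thesis by (auto simp: eventually_sequentially)
  qed
  have "AE \<omega> in M. \<forall>n. 0 \<le> Vbar V (Z \<omega> + c n) (K (Z \<omega>))"
    "AE \<omega> in M. \<forall>n. Vbar V (Z \<omega> - c n) (K (Z \<omega>)) \<le> 0"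
    using AE_up AE_dn c by (auto simp: AE_all_countable)
  moreover have "AE \<omega> in M. K (Z \<omega>) \<in> id_class V"
    using assms(18) by (simp add: Z_def)
  ultimately have "AE \<omega> in M. ereal (Z \<omega>) \<in> induced_functional V (K (Z \<omega>))"
  proof eventually_elim
    case (elim \<omega>)
    \<comment> \<open>Membership in \<open>id_class V\<close> is essential here: a default value 0
      of a non-integrable term could break monotonicity.\<close>
    have Vbar_mono: "Vbar V z (K (Z \<omega>)) \<le> Vbar V z' (K (Z \<omega>))" if "z \<le> z'" for z z'
      unfolding Vbar_def using elim(3) mono[OF that] by (intro integral_mono) (auto simp: id_class_def)
    \<comment> \<open>A point \<open>z > Z \<omega>\<close> exceeds some
      \<open>Z \<omega> + c n\<close>, where \<open>Vbar\<close> is already nonnegative, so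
      \<open>Z \<omega>\<close> bounds the set in \<open>T_lower\<close> from above; the bound for
      \<open>T_upper\<close> is symmetric. Empty sets are covered too, since the extrema are taken
      in \<open>ereal\<close>.\<close>
    have "z \<le> Z \<omega>" if "Vbar V z (K (Z \<omega>)) < 0" for z
    proof (rule ccontr)
      assume "\<not> z \<le> Z \<omega>"
      then obtain n where "c n < z - Z \<omega>" using c_small[of "z - Z \<omega>"] by auto
      then show False
        using Vbar_mono[of "Z \<omega> + c n" z] elim(1)[rule_format, of n] that by simp
    qed
    moreover have "Z \<omega> \<le> z" if "Vbar V z (K (Z \<omega>)) > 0" for z
    proof (rule ccontr)
      assume "\<not> Z \<omega> \<le> z"
      then obtain n where "c n < Z \<omega> - z" using c_small[of "Z \<omega> - z"] by auto
      then show False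
        using Vbar_mono[of z "Z \<omega> - c n"] elim(2)[rule_format, of n] that by simp
    qed
    ultimately show ?case
      by (auto simp: induced_functional_def T_lower_def T_upper_def intro!: Sup_least Inf_greatest)
  qed
  then show ?thesis by (simp add: Z_def)
qed

end
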